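(* Let $Q=(q_{ij})$ be a real symmetric $n\times n$ matrix with zero diagonal, $c\in\mathbb{R}^n$, $R_i=\{j:q_{ij}\neq0\}$, $R^-_i=\{j:q_{ij}<0\}$, and let $\alpha_{ij}>0$ for $j\in R^-_i$ and $\gamma_{ij}>0,\delta_{ij}>0$ for $j\in R_i$, $i=1,\dots,n$. Consider the MILP ORGW($\alpha,\gamma+\delta$) in variables $x_i$ and $y_{ij}$ ($j\in R_i$): maximize $\sum_{i=1}^n\sum_{j\in R_i}q_{ij}y_{ij}+\sum_{i=1}^n c_ix_i$ subject to $\sum_{j\in R^-_i}\alpha_{ij}(x_j-y_{ij})\le\left(\sum_{j\in R^-_i}\alpha_{ij}\right)(1-x_i)$ for $i=1,\dots,n$; $\sum_{j\in R_i}\gamma_{ij}y_{ij}+\sum_{j\in R_i}\delta_{ij}y_{ji}\le\left(\sum_{j\in R_i}\gamma_{ij}+\sum_{j\in R_i}\delta_{ij}\right)x_i$ for $i=1,\dots,n$; $x_i\in\{0,1\}$ for all $i$; $0\le y_{ij}\le 1$ for all $j\in R_i$, $i=1,\dots,n$. Then ORGW($\alpha,\gamma+\delta$) is a valid formulation of QUBO.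
   Context: QUBO is the problem: maximize $\sum_{i=1}^n\sum_{j\in R_i}q_{ij}x_ix_j+\sum_{i=1}^n c_ix_i$ over $x\in\{0,1\}^n$. An MILP in variables $(x,y)$ with objective $\sum_i\sum_{j\in R_i}q_{ij}y_{ij}+\sum_i c_ix_i$ is a valid formulation of QUBO if its optimal objective value equals the optimal value of QUBO and the $x$-part of every optimal solution of the MILP is an optimal solution of QUBO (the variables $y_{ij}$ need only equal $x_ix_j$ at optimal solutions). *)

theory Defs
  imports "HOL-Analysis.Analysis"
begin

definition R :: "real^'n^'n \<Rightarrow> 'n \<Rightarrow> 'n set" where
  "R Q i = {j. Q $ i $ j \<noteq> 0}"

definition R_neg :: "real^'n^'n \<Rightarrow> 'n \<Rightarrow> 'n set" where
  "R_neg Q i = {j. Q $ i $ j < 0}"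

definition binary_vectors :: "(real^'n) set" where
  "binary_vectors = {x. \<forall>i. x $ i \<in> {0, 1}}"

definition qubo_objective :: "real^'n^'n \<Rightarrow> real^'n \<Rightarrow> real^'n \<Rightarrow> real" where
  "qubo_objective Q c x =
     (\<Sum>i\<in>UNIV. \<Sum>j\<in>R Q i. Q $ i $ j * x $ i * x $ j) + (\<Sum>i\<in>UNIV. c $ i * x $ i)"

definition milp_objective ::
    "real^'n^'n \<Rightarrow> real^'n \<Rightarrow> (real^'n) \<times> ('n \<times> 'n \<Rightarrow> real) \<Rightarrow> real" where
  "milp_objective Q c = (\<lambda>(x, y).
     (\<Sum>i\<in>UNIV. \<Sum>j\<in>R Q i. Q $ i $ j * y (i, j)) + (\<Sum>i\<in>UNIV. c $ i * x $ i))"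

definition optimal_solution :: "('a \<Rightarrow> real) \<Rightarrow> 'a set \<Rightarrow> 'a \<Rightarrow> bool" where
  "optimal_solution f F s \<longleftrightarrow> is_arg_max f (\<lambda>t. t \<in> F) s"

text \<open>The optimal value is a relation, so that it is asserted to be attained.\<close>

definition optimal_value :: "('a \<Rightarrow> real) \<Rightarrow> 'a set \<Rightarrow> real \<Rightarrow> bool" where
  "optimal_value f F v \<longleftrightarrow> (\<exists>s. optimal_solution f F s \<and> f s = v)"

text \<open>\<open>F\<close> is the feasible set of an MILP in variables \<open>(x, y)\<close>.\<close>

definition valid_qubo_formulation ::
    "real^'n^'n \<Rightarrow> real^'n \<Rightarrow> ((real^'n) \<times> ('n \<times> 'n \<Rightarrow> real)) set \<Rightarrow> bool" where
  "valid_qubo_formulation Q c F \<longleftrightarrow>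
     (\<exists>v. optimal_value (milp_objective Q c) F v \<and>
          optimal_value (qubo_objective Q c) binary_vectors v) \<and>
     (\<forall>x y. optimal_solution (milp_objective Q c) F (x, y) \<longrightarrow>
            optimal_solution (qubo_objective Q c) binary_vectors x)"

text \<open>There is a variable \<open>y (i, j)\<close> only for \<open>j \<in> R Q i\<close>: the extensional function space
  supplies exactly these variables, together with their bounds \<open>0 \<le> y (i, j) \<le> 1\<close>.\<close>

definition ORGW ::
    "real^'n^'n \<Rightarrow> ('n \<Rightarrow> 'n \<Rightarrow> real) \<Rightarrow> ('n \<Rightarrow> 'n \<Rightarrow> real) \<Rightarrow> ('n \<Rightarrow> 'n \<Rightarrow> real) \<Rightarrow>
     ((real^'n) \<times> ('n \<times> 'n \<Rightarrow> real)) set" where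
  "ORGW Q \<alpha> \<gamma> \<delta> = {(x, y).
     (\<forall>i. (\<Sum>j\<in>R_neg Q i. \<alpha> i j * (x $ j - y (i, j)))
            \<le> (\<Sum>j\<in>R_neg Q i. \<alpha> i j) * (1 - x $ i)) \<and>
     (\<forall>i. (\<Sum>j\<in>R Q i. \<gamma> i j * y (i, j)) + (\<Sum>j\<in>R Q i. \<delta> i j * y (j, i))
            \<le> ((\<Sum>j\<in>R Q i. \<gamma> i j) + (\<Sum>j\<in>R Q i. \<delta> i j)) * x $ i) \<and>
     x \<in> binary_vectors \<and>
     y \<in> (SIGMA i:UNIV. R Q i) \<rightarrow>\<^sub>E {0..1}}"

end

theory Submission
  imports Defs
begin

text \<open>The second constraint forces \<open>y (i, j) = 0\<close> as soon as \<open>x $ i = 0\<close> or \<open>x $ j = 0\<close>, so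
  \<open>y (i, j) \<le> x $ i * x $ j\<close> throughout. If \<open>x $ i = 1\<close>, the left-hand side of the first
  constraint is therefore a sum of nonnegative terms bounded by \<open>0\<close>, which gives equality where
  \<open>Q $ i $ j < 0\<close>. Hence the MILP objective is at most the QUBO objective at \<open>x\<close>, and
  \<open>y (i, j) = x $ i * x $ j\<close> is feasible and attains it.\<close>

lemma optimal_solution_iff:
  "optimal_solution f F s \<longleftrightarrow> s \<in> F \<and> (\<forall>t\<in>F. f t \<le> f s)"
  by (auto simp: optimal_solution_def is_arg_max_linorder)

text \<open>\<open>F\<close> relaxes QUBO from below, and the lift \<open>Y\<close> attains the
  bound at every binary \<open>x\<close>. The two maxima then coincide, and a maximizer
  \<open>x0\<close> of QUBO lifts to a maximizer over \<open>F\<close>.\<close>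

lemma valid_qubo_formulationI:
  assumes bound: "\<And>x y. (x, y) \<in> F \<Longrightarrow>
      x \<in> binary_vectors \<and> milp_objective Q c (x, y) \<le> qubo_objective Q c x"
    and lift: "\<And>x. x \<in> binary_vectors \<Longrightarrow>
      (x, Y x) \<in> F \<and> milp_objective Q c (x, Y x) = qubo_objective Q c x"
    and opt: "optimal_solution (qubo_objective Q c) binary_vectors x0"
  shows "valid_qubo_formulation Q c F"
proof -
  have x0: "x0 \<in> binary_vectors"
    and max: "\<And>x. x \<in> binary_vectors \<Longrightarrow> qubo_objective Q c x \<le> qubo_objective Q c x0"
    using opt by (auto simp: optimal_solution_iff)
  have "optimal_solution (milp_objective Q c) F (x0, Y x0)"
    unfolding optimal_solution_iff using x0 lift bound max by (fastforce intro: order_trans)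
  then have "optimal_value (milp_objective Q c) F (qubo_objective Q c x0)"
    unfolding optimal_value_def using lift[OF x0] by blast
  moreover have "optimal_value (qubo_objective Q c) binary_vectors (qubo_objective Q c x0)"
    unfolding optimal_value_def using opt by blast
  moreover have "optimal_solution (qubo_objective Q c) binary_vectors x"
    if xy: "optimal_solution (milp_objective Q c) F (x, y)" for x y
  proof -
    \<comment> \<open>The chain runs through the lift of the competitor: QUBO at \<open>t\<close> is
      the MILP value at \<open>(t, Y t)\<close>, at most that at \<open>(x, y)\<close>, at most QUBO
      at \<open>x\<close>.\<close>
    have "qubo_objective Q c t \<le> qubo_objective Q c x" if "t \<in> binary_vectors" for t
      using xy lift[OF that] bound[of x y] unfolding optimal_solution_iff by fastforce
    then show ?thesis
      using xy bound unfolding optimal_solution_iff by blast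
  qed
  ultimately show ?thesis
    unfolding valid_qubo_formulation_def by blast
qed

lemma finite_binary_vectors: "finite (binary_vectors :: (real^'n) set)"
proof (rule finite_subset)
  show "binary_vectors \<subseteq> vec_lambda ` (UNIV \<rightarrow>\<^sub>E {0, 1 :: real} :: ('n \<Rightarrow> real) set)"
  proof
    fix x :: "real^'n" assume "x \<in> binary_vectors"
    then show "x \<in> vec_lambda ` (UNIV \<rightarrow>\<^sub>E {0, 1})"
      by (intro image_eqI[where x = "vec_nth x"]) (auto simp: binary_vectors_def)
  qed
  show "finite (vec_lambda ` (UNIV \<rightarrow>\<^sub>E {0, 1 :: real} :: ('n \<Rightarrow> real) set))"
    by (intro finite_imageI finite_PiE) auto
qed

text \<open>Optimal values have to be attained; a nonempty finite set of candidates ensures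
  this.\<close>

lemma qubo_has_optimal_solution:
  fixes Q :: "real^'n^'n"
  obtains x where "optimal_solution (qubo_objective Q c) binary_vectors x"
proof -
  let ?B = "binary_vectors :: (real^'n) set"
  have "0 \<in> ?B"
    by (simp add: binary_vectors_def)
  then have "?B \<noteq> {}"
    by blast
  from obtains_MAX[OF finite_binary_vectors this, of "qubo_objective Q c"]
  obtain x where "x \<in> ?B" "Max (qubo_objective Q c ` ?B) = qubo_objective Q c x" .
  then show ?thesis
    using that[of x] Max_ge[of "qubo_objective Q c ` ?B"]
    by (auto simp: optimal_solution_iff finite_binary_vectors)
qed

text \<open>Symmetry makes \<open>y (j, i)\<close> a genuine variable, with its bounds, whenever
  \<open>y (i, j)\<close> is one.\<close>

lemma mem_R_sym:
  fixes Q :: "real^'n^'n"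
  assumes "transpose Q = Q"
  shows "j \<in> R Q i \<longleftrightarrow> i \<in> R Q j"
proof -
  have "transpose Q $ i $ j = Q $ j $ i"
    by (simp add: transpose_def)
  then show ?thesis
    using assms by (simp add: R_def)
qed

lemma binary_cases:
  assumes "x \<in> binary_vectors"
  obtains "x $ i = 0" | "x $ i = 1"
  using assms by (auto simp: binary_vectors_def)

context
  fixes Q :: "real^'n^'n" and \<alpha> \<gamma> \<delta> :: "'n \<Rightarrow> 'n \<Rightarrow> real"
  assumes sym: "transpose Q = Q"
    and \<alpha>_pos: "\<And>i j. j \<in> R_neg Q i \<Longrightarrow> \<alpha> i j > 0"
    and \<gamma>_pos: "\<And>i j. j \<in> R Q i \<Longrightarrow> \<gamma> i j > 0"
    and \<delta>_pos: "\<And>i j. j \<in> R Q i \<Longrightarrow> \<delta> i j > 0"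
begin

text \<open>Nonnegative terms whose total is at most \<open>0\<close> all vanish, and the positive
  weights can be cancelled. The \<gamma> terms handle row \<open>i\<close>, the \<delta> terms
  column \<open>i\<close>.\<close>

lemma ORGW_y_eq_0:
  assumes "(x, y) \<in> ORGW Q \<alpha> \<gamma> \<delta>" "x $ i = 0" "j \<in> R Q i"
  shows "y (i, j) = 0" "y (j, i) = 0"
proof -
  have y: "y (i, k) \<ge> 0" "y (k, i) \<ge> 0" if "k \<in> R Q i" for k
    using assms(1) that mem_R_sym[OF sym, of i k] by (auto simp: ORGW_def PiE_def Pi_def)
  have nonneg: "0 \<le> \<gamma> i k * y (i, k)" "0 \<le> \<delta> i k * y (k, i)" if "k \<in> R Q i" for k
    using y[OF that] \<gamma>_pos[OF that] \<delta>_pos[OF that] by simp_all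
  have "(\<Sum>k\<in>R Q i. \<gamma> i k * y (i, k)) + (\<Sum>k\<in>R Q i. \<delta> i k * y (k, i))
      \<le> ((\<Sum>k\<in>R Q i. \<gamma> i k) + (\<Sum>k\<in>R Q i. \<delta> i k)) * x $ i"
    using assms(1) unfolding ORGW_def by blast
  then have "(\<Sum>k\<in>R Q i. \<gamma> i k * y (i, k) + \<delta> i k * y (k, i)) \<le> 0"
    using assms(2) by (simp add: sum.distrib)
  then have "(\<Sum>k\<in>R Q i. \<gamma> i k * y (i, k) + \<delta> i k * y (k, i)) = 0"
    using nonneg by (intro antisym sum_nonneg) (auto intro: add_nonneg_nonneg)
  then have "\<gamma> i j * y (i, j) + \<delta> i j * y (j, i) = 0"
    using nonneg assms(3) by (subst (asm) sum_nonneg_eq_0_iff) (auto intro: add_nonneg_nonneg)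
  then have "\<gamma> i j * y (i, j) = 0" "\<delta> i j * y (j, i) = 0"
    using nonneg[OF assms(3)] by linarith+
  then show "y (i, j) = 0" "y (j, i) = 0"
    using \<gamma>_pos[OF assms(3)] \<delta>_pos[OF assms(3)] by simp_all
qed

lemma ORGW_y_le:
  assumes "(x, y) \<in> ORGW Q \<alpha> \<gamma> \<delta>" "j \<in> R Q i"
  shows "y (i, j) \<le> x $ i * x $ j"
proof -
  have x: "x \<in> binary_vectors" and y: "y (i, j) \<le> 1"
    using assms by (auto simp: ORGW_def PiE_def Pi_def)
  \<comment> \<open>This covers the case \<open>x $ j = 0\<close>: \<open>ORGW_y_eq_0\<close> at
    index \<open>j\<close> makes the column entry \<open>y (i, j)\<close> vanish. If both variables
    are \<open>1\<close>, the bound \<open>y (i, j) \<le> 1\<close> suffices.\<close>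
  have "i \<in> R Q j"
    using assms(2) mem_R_sym[OF sym] by blast
  then show ?thesis
    using ORGW_y_eq_0[OF assms(1)] assms(2) y
    by (cases rule: binary_cases[OF x, of i]; cases rule: binary_cases[OF x, of j]) auto
qed

lemma ORGW_y_eq:
  assumes "(x, y) \<in> ORGW Q \<alpha> \<gamma> \<delta>" "j \<in> R_neg Q i"
  shows "y (i, j) = x $ i * x $ j"
proof -
  have x: "x \<in> binary_vectors"
    using assms(1) by (auto simp: ORGW_def)
  have R: "k \<in> R Q i" if "k \<in> R_neg Q i" for k
    using that by (simp add: R_def R_neg_def)
  show ?thesis
  proof (cases rule: binary_cases[OF x, of i])
    case 1
    then show ?thesis
      using ORGW_y_eq_0(1)[OF assms(1) _ R[OF assms(2)]] by simp
  next
    case 2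
    \<comment> \<open>Since \<open>x $ i = 1\<close>, the product in \<open>ORGW_y_le\<close> is
      just \<open>x $ k\<close>.\<close>
    have nonneg: "0 \<le> \<alpha> i k * (x $ k - y (i, k))" if "k \<in> R_neg Q i" for k
      using ORGW_y_le[OF assms(1) R[OF that]] \<alpha>_pos[OF that] 2 by simp
    have "(\<Sum>k\<in>R_neg Q i. \<alpha> i k * (x $ k - y (i, k))) \<le> (\<Sum>k\<in>R_neg Q i. \<alpha> i k) * (1 - x $ i)"
      using assms(1) unfolding ORGW_def by blast
    then have "(\<Sum>k\<in>R_neg Q i. \<alpha> i k * (x $ k - y (i, k))) = 0"
      using 2 nonneg by (intro antisym sum_nonneg) auto
    then have "\<alpha> i j * (x $ j - y (i, j)) = 0"
      using nonneg assms(2) by (subst (asm) sum_nonneg_eq_0_iff) auto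
    then show ?thesis
      using \<alpha>_pos[OF assms(2)] 2 by simp
  qed
qed

text \<open>The comparison is term by term. Multiplying by a negative coefficient would reverse
  \<open>ORGW_y_le\<close>, so those terms use the equality \<open>ORGW_y_eq\<close>.\<close>

lemma ORGW_milp_le_qubo:
  assumes "(x, y) \<in> ORGW Q \<alpha> \<gamma> \<delta>"
  shows "milp_objective Q c (x, y) \<le> qubo_objective Q c x"
proof -
  have "Q $ i $ j * y (i, j) \<le> Q $ i $ j * x $ i * x $ j" if "j \<in> R Q i" for i j
  proof (cases "Q $ i $ j < 0")
    case True
    then show ?thesis
      using ORGW_y_eq[OF assms, of j i] by (simp add: R_neg_def)
  next
    case False
    then show ?thesis
      using mult_left_mono[OF ORGW_y_le[OF assms that], of "Q $ i $ j"] by (simp add: mult.assoc)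
  qed
  then show ?thesis
    unfolding milp_objective_def qubo_objective_def by (auto intro!: sum_mono)
qed

text \<open>Once the right-hand sides are distributed over their sums, both constraints hold for
  each \<open>j\<close> separately, because a product of binary values is at most either
  factor.\<close>

lemma product_mem_ORGW:
  assumes x: "x \<in> binary_vectors"
  shows "(x, restrict (\<lambda>(i, j). x $ i * x $ j) (SIGMA i:UNIV. R Q i)) \<in> ORGW Q \<alpha> \<gamma> \<delta>"
    (is "(x, ?y) \<in> _")
proof -
  have x01: "0 \<le> x $ i" "x $ i \<le> 1" for i
    using x by (cases rule: binary_cases[of x i]; simp)+
  \<comment> \<open>Off the index set \<open>restrict\<close> yields \<open>undefined\<close>, so
    the second equation needs \<open>(j, i)\<close> to be an index as well.\<close>
  have y: "?y (i, j) = x $ i * x $ j" "?y (j, i) = x $ i * x $ j" if "j \<in> R Q i" for i j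
    using that mem_R_sym[OF sym, of i j] by (auto simp: mult.commute)
  have "(\<Sum>j\<in>R_neg Q i. \<alpha> i j * (x $ j - ?y (i, j))) \<le> (\<Sum>j\<in>R_neg Q i. \<alpha> i j) * (1 - x $ i)" for i
    unfolding sum_distrib_right
  proof (rule sum_mono)
    fix j assume j: "j \<in> R_neg Q i"
    have "x $ j - ?y (i, j) = x $ j * (1 - x $ i)"
      using j y(1)[of j i] by (simp add: R_def R_neg_def algebra_simps)
    also have "\<dots> \<le> 1 * (1 - x $ i)"
      using x01 by (intro mult_right_mono) auto
    finally show "\<alpha> i j * (x $ j - ?y (i, j)) \<le> \<alpha> i j * (1 - x $ i)"
      using \<alpha>_pos[OF j] by (intro mult_left_mono) auto
  qed
  moreover have "(\<Sum>j\<in>R Q i. \<gamma> i j * ?y (i, j)) + (\<Sum>j\<in>R Q i. \<delta> i j * ?y (j, i))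
      \<le> ((\<Sum>j\<in>R Q i. \<gamma> i j) + (\<Sum>j\<in>R Q i. \<delta> i j)) * x $ i" for i
  proof -
    have "x $ i * x $ j \<le> x $ i" for j
      using x01 by (simp add: mult_left_le)
    then show ?thesis
      unfolding distrib_right sum_distrib_right
      using \<gamma>_pos \<delta>_pos y by (intro add_mono sum_mono mult_left_mono) (auto intro: less_imp_le)
  qed
  moreover have "?y \<in> (SIGMA i:UNIV. R Q i) \<rightarrow>\<^sub>E {0..1}"
    using mult_le_one[OF x01(2) x01(1) x01(2)] by (auto simp: x01)
  ultimately show ?thesis
    using x unfolding ORGW_def by blast
qed

end

text \<open>The objective reads \<open>y\<close> only at indices in the Sigma set, where
  \<open>restrict\<close> changes nothing.\<close>

lemma milp_objective_product:
  "milp_objective Q c (x, restrict (\<lambda>(i, j). x $ i * x $ j) (SIGMA i:UNIV. R Q i))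
    = qubo_objective Q c x"
  by (simp add: milp_objective_def qubo_objective_def mult.assoc)

theorem theorem19:
  fixes Q :: "real^'n^'n" and c :: "real^'n"
    and \<alpha> \<gamma> \<delta> :: "'n \<Rightarrow> 'n \<Rightarrow> real"
  assumes "transpose Q = Q"
    and "\<And>i. Q $ i $ i = 0"
    and "\<And>i j. j \<in> R_neg Q i \<Longrightarrow> \<alpha> i j > 0"
    and "\<And>i j. j \<in> R Q i \<Longrightarrow> \<gamma> i j > 0"
    and "\<And>i j. j \<in> R Q i \<Longrightarrow> \<delta> i j > 0"
  shows "valid_qubo_formulation Q c (ORGW Q \<alpha> \<gamma> \<delta>)"
proof -
  obtain x0 where "optimal_solution (qubo_objective Q c) binary_vectors x0"
    by (rule qubo_has_optimal_solution)
  moreover have "x \<in> binary_vectors \<and> milp_objective Q c (x, y) \<le> qubo_objective Q c x"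
    if "(x, y) \<in> ORGW Q \<alpha> \<gamma> \<delta>" for x y
    using that ORGW_milp_le_qubo[OF assms(1,3-5) that] by (simp add: ORGW_def)
  moreover note product_mem_ORGW[where \<alpha> = \<alpha> and \<gamma> = \<gamma> and \<delta> = \<delta>, OF assms(1,3-5)]
  ultimately show ?thesis
    using milp_objective_product
    by (intro valid_qubo_formulationI[where
          Y = "\<lambda>x. restrict (\<lambda>(i, j). x $ i * x $ j) (SIGMA i:UNIV. R Q i)"]) auto
qed

end
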